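(* Suppose $(\mathcal P,\mathcal Q)=(\mathcal P_n,\mathcal Q_n)$ satisfies the Rényi stability upper bound assumption. Suppose $\log(p_{1M}^{-1})=(1+o(1))\log(N/m)=\omega(1)$ and $D_{\mathrm{KL}}(\mathcal P\|\mathcal Q)=(1+\eta)\log(p_{1M}^{-1})$ for some constant $\eta>0$. Then, in the hidden weighted graph model, selecting the $m$ edges $e$ of $K_n$ with the highest likelihood ratios $\frac{d\mathcal P}{d\mathcal Q}(A_e)$ outputs, with high probability, an $m$-edge subset with more than $(1-o(1))m$ edges belonging to the hidden graph $H^*$; that is, if $S$ is the selected set, there is a sequence $\epsilon_n\to0$ with $\Pr[|S\cap H^*|>(1-\epsilon_n)m]\to1$ as $n\to\infty$.
   Context: Hidden weighted graph model. For each positive integer $n$, let $K_n$ be the complete graph on $n$ labelled vertices and $N=\binom n2$ its number of edges. $\mathcal H=\mathcal H_n$ is a nonempty collection of subgraphs of $K_n$ (identified with their edge sets), each having exactly $m=m_n$ edges, where $m\to\infty$ as $n\to\infty$. $\mathcal P=\mathcal P_n$ and $\mathcal Q=\mathcal Q_n$ are probability distributions (of edge weights) with $\mathcal P\ll\mathcal Q$. A graph $H^*$ is drawn uniformly at random from $\mathcal H$; conditionally on $H^*$, the weights $A_e$ of the edges $e$ of $K_n$ are independent, with $A_e\sim\mathcal P$ if $e\in H^*$ and $A_e\sim\mathcal Q$ otherwise. The selected $m$-edge set need not belong to $\mathcal H$. $M=|\mathcal H|$ and $p_{1M}=M^{-1/m}$; $\log$ is natural. Rényi divergence: $D_\alpha(\mathcal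 P\|\mathcal Q)=\frac1{\alpha-1}\log\mathbb E_{\mathcal P}\big[(\frac{d\mathcal P}{d\mathcal Q})^{\alpha-1}\big]$ for $\alpha\in(0,1)\cup(1,\infty)$. Rényi stability upper bound assumption: for any fixed $\theta>0$ there exists $\alpha_n\in(0,1)$ with $\alpha_n\to1$ and $1-\alpha_n=\omega(1/D_{\mathrm{KL}}(\mathcal P\|\mathcal Q))$ such that $D_{\alpha_n}(\mathcal P\|\mathcal Q)\ge(1-\theta)D_{\mathrm{KL}}(\mathcal P\|\mathcal Q)$ for all sufficiently large $n$. *)

theory Defs
  imports "HOL-Probability.Probability" "HOL-Library.Landau_Symbols"
begin

definition complete_graph_edges :: "nat \<Rightarrow> nat set set" where
  "complete_graph_edges n = {e. e \<subseteq> {1..n} \<and> card e = 2}"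

definition likelihood_ratio :: "'a measure \<Rightarrow> 'a measure \<Rightarrow> 'a \<Rightarrow> real" where
  "likelihood_ratio P Q x = enn2real (RN_deriv Q P x)"

text \<open>
  The library's \<^const>\<open>KL_divergence\<close> takes the reference measure first, and its value is the
  Bochner integral of the log-likelihood ratio under \<open>P\<close>. For \<open>P \<lless> Q\<close> the negative part of that
  function is always integrable, so the only case where this real number is not the divergence is
  an infinite divergence, for which it is 0. A nonzero value is therefore always the true
  (finite) divergence.
\<close>

abbreviation KL_div :: "'a measure \<Rightarrow> 'a measure \<Rightarrow> real" where
  "KL_div P Q \<equiv> KL_divergence (exp 1) Q P"

text \<open>
  For \<open>0 < \<alpha> < 1\<close> and probability measures \<open>P \<lless> Q\<close> the expectation is finite and lies in
  \<open>{0<..1}\<close>, so that the real-valued integral and logarithm below are the intended ones. (For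
  \<open>\<alpha> > 1\<close> they are so only if the integrand is integrable.)
\<close>

definition renyi_divergence :: "real \<Rightarrow> 'a measure \<Rightarrow> 'a measure \<Rightarrow> real" where
  "renyi_divergence \<alpha> P Q =
     1 / (\<alpha> - 1) * ln (\<integral>x. likelihood_ratio P Q x powr (\<alpha> - 1) \<partial>P)"

definition renyi_stable_upper :: "(nat \<Rightarrow> 'a measure) \<Rightarrow> (nat \<Rightarrow> 'a measure) \<Rightarrow> bool" where
  "renyi_stable_upper P Q \<longleftrightarrow>
     (\<forall>\<theta>>0. \<exists>\<alpha>::nat \<Rightarrow> real.
        (\<forall>n. 0 < \<alpha> n \<and> \<alpha> n < 1) \<and>
        \<alpha> \<longlonglongrightarrow> 1 \<and>
        (\<lambda>n. 1 - \<alpha> n) \<in> \<omega>(\<lambda>n. 1 / KL_div (P n) (Q n)) \<and>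
        (\<forall>\<^sub>F n in sequentially.
           renyi_divergence (\<alpha> n) (P n) (Q n) \<ge> (1 - \<theta>) * KL_div (P n) (Q n)))"

text \<open>
  The joint law of the hidden graph \<open>h\<close> and the edge weights \<open>A\<close> when \<open>E\<close> is the set of all edges
  and \<open>H\<close> the collection of possible hidden graphs.
\<close>

definition hidden_weighted_graph ::
    "'e set \<Rightarrow> 'e set set \<Rightarrow> 'a measure \<Rightarrow> 'a measure \<Rightarrow> ('e set \<times> ('e \<Rightarrow> 'a)) measure" where
  "hidden_weighted_graph E H P Q =
     measure_pmf (pmf_of_set H) \<bind>
       (\<lambda>h. distr (\<Pi>\<^sub>M e\<in>E. if e \<in> h then P else Q)
                  (count_space UNIV \<Otimes>\<^sub>M (\<Pi>\<^sub>M e\<in>E. Q))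
                  (Pair h))"

text \<open>
  \<open>S\<close> consists of \<open>k\<close> edges with the highest likelihood ratios. When there are ties, several
  sets \<open>S\<close> qualify.
\<close>

definition top_likelihood_selection ::
    "'e set \<Rightarrow> nat \<Rightarrow> 'a measure \<Rightarrow> 'a measure \<Rightarrow> ('e \<Rightarrow> 'a) \<Rightarrow> 'e set \<Rightarrow> bool" where
  "top_likelihood_selection E k P Q A S \<longleftrightarrow>
     S \<subseteq> E \<and> card S = k \<and>
     (\<forall>e\<in>S. \<forall>f\<in>E - S. likelihood_ratio P Q (A f) \<le> likelihood_ratio P Q (A e))"

end

theory Submission
  imports Defs
begin

text \<open>
  Let \<open>l = log (1 / p\<^bsub>1M\<^esub>)\<close> and cut the likelihood ratios at \<open>t = exp ((1 + \<eta> / 2) l)\<close>. If fewer than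
  \<open>\<epsilon> m\<close> edges of the hidden graph lie below \<open>t\<close> and fewer than \<open>\<epsilon> m\<close> other edges lie above it, every
  selection of \<open>m\<close> highest edges contains more than \<open>(1 - \<epsilon>) m\<close> hidden ones. Under \<open>Q\<close> the ratio has mean
  1, so on average at most \<open>N / t = m exp (log (N / m) - (1 + \<eta> / 2) l)\<close> other edges lie above \<open>t\<close>. Under
  \<open>P\<close> a Chernoff bound with the Renyi divergence of order \<open>\<alpha>\<close> shows that an edge lies below \<open>t\<close> with
  probability at most \<open>exp (- (1 - \<alpha>) (D\<^sub>\<alpha> - (1 + \<eta> / 2) l))\<close>, and this vanishes because
  \<open>(1 - \<alpha>) D\<^sub>K\<^sub>L\<close> tends to infinity. Both counts are then controlled by Markov's inequality, which
  needs only the marginal laws of the weights.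
\<close>

section \<open>Likelihood ratios and their tails under \<open>P\<close> and \<open>Q\<close>\<close>

locale abs_cont_prob_pair = P: prob_space P + Q: prob_space Q
  for P Q :: "'a measure" +
  assumes sets_eq: "sets P = sets Q"
    and abs_cont: "absolutely_continuous Q P"
begin

lemma space_eq: "space P = space Q"
  using sets_eq by (rule sets_eq_imp_space_eq)

lemma likelihood_ratio_nonneg: "0 \<le> likelihood_ratio P Q x"
  by (simp add: likelihood_ratio_def)

lemma likelihood_ratio_measurable [measurable]: "likelihood_ratio P Q \<in> borel_measurable Q"
  unfolding likelihood_ratio_def [abs_def] by measurable

lemma likelihood_ratio_measurable' [measurable]: "likelihood_ratio P Q \<in> borel_measurable P"
  using likelihood_ratio_measurable sets_eq by (simp cong: measurable_cong_sets)

text \<open>The derivative is finite \<open>Q\<close>-almost everywhere, so \<open>enn2real\<close>,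
  which sends infinity to 0, changes it only on a null set.\<close>

lemma density_likelihood_ratio: "density Q (\<lambda>x. ennreal (likelihood_ratio P Q x)) = P"
proof -
  have "density Q (RN_deriv Q P) = density Q (\<lambda>x. ennreal (likelihood_ratio P Q x))"
  proof (rule density_cong)
    show "AE x in Q. RN_deriv Q P x = ennreal (likelihood_ratio P Q x)"
      using Q.RN_deriv_finite [OF P.sigma_finite_measure_axioms abs_cont sets_eq]
      by eventually_elim (auto simp: less_top likelihood_ratio_def)
  qed (auto simp: likelihood_ratio_def)
  then show ?thesis
    using Q.density_RN_deriv [OF abs_cont sets_eq] by simp
qed

lemma integrable_iff_likelihood_ratio:
  fixes f :: "'a \<Rightarrow> real"
  assumes "f \<in> borel_measurable Q"
  shows "integrable P f \<longleftrightarrow> integrable Q (\<lambda>x. likelihood_ratio P Q x * f x)"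
  by (subst density_likelihood_ratio [symmetric], subst integrable_real_density)
    (use assms in \<open>auto simp: likelihood_ratio_nonneg\<close>)

lemma integral_likelihood_ratio:
  fixes f :: "'a \<Rightarrow> real"
  assumes "f \<in> borel_measurable Q"
  shows "(\<integral>x. f x \<partial>P) = (\<integral>x. likelihood_ratio P Q x * f x \<partial>Q)"
  by (subst (1) density_likelihood_ratio [symmetric], subst integral_real_density)
    (use assms in \<open>auto simp: likelihood_ratio_nonneg\<close>)

lemma integrable_likelihood_ratio: "integrable Q (likelihood_ratio P Q)"
  using integrable_iff_likelihood_ratio [of "\<lambda>_. 1"] by simp

text \<open>Zeros of a density carry no mass. This matters because
  \<open>0 powr (\<alpha> - 1)\<close> is 0 by convention, whereas the Renyi integrand should be
  infinite there.\<close>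

lemma AE_likelihood_ratio_pos: "AE x in P. 0 < likelihood_ratio P Q x"
  by (subst (1) density_likelihood_ratio [symmetric], subst AE_density) auto

lemma prob_likelihood_ratio_ge:
  assumes "0 < t"
  shows "Q.prob {x \<in> space Q. t \<le> likelihood_ratio P Q x} \<le> 1 / t"
proof -
  have "Q.prob {x \<in> space Q. t \<le> likelihood_ratio P Q x}
      \<le> (\<integral>x. likelihood_ratio P Q x \<partial>Q) / t"
    using assms by (intro integral_Markov_inequality_measure [of _ _ "{}"])
      (auto simp: likelihood_ratio_nonneg integrable_likelihood_ratio)
  also have "(\<integral>x. likelihood_ratio P Q x \<partial>Q) = 1"
    using integral_likelihood_ratio [of "\<lambda>_. 1"] by (simp add: P.prob_space)
  finally show ?thesis .
qed

text \<open>The integrand may be unbounded near ratio 0. Passing to \<open>Q\<close> multiplies it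
  by the ratio \<open>y\<close>, and the resulting power \<open>y powr \<alpha>\<close> is dominated
  by the \<open>Q\<close>-integrable \<open>1 + y\<close>.\<close>

lemma integrable_likelihood_ratio_powr:
  assumes "0 < \<alpha>" "\<alpha> < 1"
  shows "integrable P (\<lambda>x. likelihood_ratio P Q x powr (\<alpha> - 1))"
proof -
  have *: "y * y powr (\<alpha> - 1) \<le> 1 + y" if "0 \<le> y" for y :: real
  proof (cases "y \<le> 1")
    case True
    have "y * y powr (\<alpha> - 1) = y powr \<alpha>"
      using that by (cases "y = 0") (auto simp: powr_diff)
    also have "\<dots> \<le> 1"
      using True that assms by (intro powr_le1) auto
    finally show ?thesis
      using that by simp
  next
    case False
    then have "y powr (\<alpha> - 1) \<le> y powr 0"
      using assms by (intro powr_mono) auto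
    then have "y * y powr (\<alpha> - 1) \<le> y * 1"
      using False by (intro mult_left_mono) auto
    then show ?thesis
      by linarith
  qed
  have "integrable Q (\<lambda>x. likelihood_ratio P Q x * likelihood_ratio P Q x powr (\<alpha> - 1))"
    by (rule Bochner_Integration.integrable_bound [where f = "\<lambda>x. 1 + likelihood_ratio P Q x"])
      (auto simp: integrable_likelihood_ratio likelihood_ratio_nonneg *)
  then show ?thesis
    by (subst integrable_iff_likelihood_ratio) auto
qed

text \<open>The Chernoff bound for \<open>- ln (likelihood_ratio P Q)\<close> with exponent \<open>1 - \<alpha>\<close>.\<close>

lemma prob_likelihood_ratio_less:
  assumes \<alpha>: "0 < \<alpha>" "\<alpha> < 1"
  shows "P.prob {x \<in> space P. likelihood_ratio P Q x < exp s}
    \<le> exp (- (1 - \<alpha>) * (renyi_divergence \<alpha> P Q - s))"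
proof -
  let ?L = "likelihood_ratio P Q"
  define I where "I = (\<integral>x. ?L x powr (\<alpha> - 1) \<partial>P)"
  note int = integrable_likelihood_ratio_powr [OF \<alpha>]
  \<comment> \<open>Positivity makes \<open>ln I\<close> a genuine logarithm, so that exponentiating
    the divergence recovers \<open>I\<close>.\<close>
  have "I \<noteq> 0"
  proof
    assume "I = 0"
    then have "AE x in P. ?L x powr (\<alpha> - 1) = 0"
      unfolding I_def using int by (subst (asm) integral_nonneg_eq_0_iff_AE) auto
    with AE_likelihood_ratio_pos have "AE x in P. False"
      by eventually_elim auto
    then show False
      by simp
  qed
  moreover have "I \<ge> 0"
    unfolding I_def by simp
  ultimately have I_pos: "0 < I"
    by simp
  have I_eq: "I = exp (- (1 - \<alpha>) * renyi_divergence \<alpha> P Q)"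
    using I_pos \<alpha> by (simp add: renyi_divergence_def I_def [symmetric])
  \<comment> \<open>The exponent \<open>\<alpha> - 1\<close> is negative, so raising to it reverses
    the inequality. At ratio 0 this fails by the \<open>powr\<close> convention, hence an inclusion
    only almost everywhere.\<close>
  have "P.prob {x \<in> space P. ?L x < exp s}
      \<le> P.prob {x \<in> space P. exp (- (1 - \<alpha>) * s) \<le> ?L x powr (\<alpha> - 1)}"
  proof (rule P.finite_measure_mono_AE)
    show "AE x in P. x \<in> {x \<in> space P. ?L x < exp s} \<longrightarrow>
        x \<in> {x \<in> space P. exp (- (1 - \<alpha>) * s) \<le> ?L x powr (\<alpha> - 1)}"
      using AE_likelihood_ratio_pos
    proof eventually_elim
      case (elim x)
      have "exp (- (1 - \<alpha>) * s) \<le> ?L x powr (\<alpha> - 1)" if "?L x < exp s"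
      proof -
        have "exp s powr (\<alpha> - 1) \<le> ?L x powr (\<alpha> - 1)"
          using elim that \<alpha> by (intro powr_mono2') auto
        then show ?thesis
          by (simp add: powr_def algebra_simps)
      qed
      then show ?case
        by auto
    qed
  qed measurable
  also have "\<dots> \<le> I / exp (- (1 - \<alpha>) * s)"
    unfolding I_def using int
    by (intro integral_Markov_inequality_measure [of _ _ "{}"]) auto
  also have "\<dots> = exp (- (1 - \<alpha>) * (renyi_divergence \<alpha> P Q - s))"
    by (simp add: I_eq flip: exp_diff) (simp add: algebra_simps)
  finally show ?thesis .
qed

end

section \<open>Markov's inequality for counts, and the overlap forced by few exceptional
  edges\<close>

lemma (in prob_space) prob_card_ge:
  fixes c :: real
  assumes "finite I" "0 < c"
    and meas: "\<And>i. i \<in> I \<Longrightarrow> {x \<in> space M. X i x} \<in> events"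
  shows "prob {x \<in> space M. c \<le> real (card {i \<in> I. X i x})}
    \<le> (\<Sum>i\<in>I. prob {x \<in> space M. X i x}) / c"
proof -
  define Y where "Y i = {x \<in> space M. X i x}" for i
  have Y: "Y i \<in> events" if "i \<in> I" for i
    using meas [OF that] by (simp add: Y_def)
  have card_eq: "real (card {i \<in> I. X i x}) = (\<Sum>i\<in>I. indicator (Y i) x)"
    if "x \<in> space M" for x
    using that \<open>finite I\<close> by (simp add: Y_def indicator_def Int_def)
  have int: "integrable M (indicator (Y i) :: _ \<Rightarrow> real)" if "i \<in> I" for i
    using Y [OF that] by (simp add: emeasure_eq_measure)
  have "prob {x \<in> space M. c \<le> real (card {i \<in> I. X i x})}
      = prob {x \<in> space M. c \<le> (\<Sum>i\<in>I. indicator (Y i) x)}"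
    by (rule arg_cong [where f = prob]) (auto simp: card_eq)
  also have "\<dots> \<le> (\<integral>x. (\<Sum>i\<in>I. indicator (Y i) x) \<partial>M) / c"
    using \<open>0 < c\<close> int
    by (intro integral_Markov_inequality_measure [of _ _ "{}"]) (auto intro!: sum_nonneg)
  also have "(\<integral>x. (\<Sum>i\<in>I. indicator (Y i) x) \<partial>M) = (\<Sum>i\<in>I. prob (Y i))"
    using int Y sets.sets_into_space by (subst Bochner_Integration.integral_sum) (auto simp: Int_absorb1)
  finally show ?thesis
    by (simp add: Y_def)
qed

text \<open>If \<open>S\<close> contains an edge below \<open>t\<close>, every unselected edge is
  below \<open>t\<close> too, so all missed hidden edges are low. Otherwise \<open>S\<close> lies at
  or above \<open>t\<close>, so all wrongly selected edges are high. Either way fewer than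
  \<open>c\<close> edges are lost, however ties are broken.\<close>

lemma top_likelihood_selection_overlap:
  fixes c t :: real
  assumes "finite E" "h \<subseteq> E" "card h = k"
    and sel: "top_likelihood_selection E k P Q A S"
    and few_low: "real (card {e \<in> h. likelihood_ratio P Q (A e) < t}) < c"
    and few_high: "real (card {e \<in> E - h. t \<le> likelihood_ratio P Q (A e)}) < c"
  shows "real k - c < real (card (S \<inter> h))"
proof -
  let ?low = "{e \<in> h. likelihood_ratio P Q (A e) < t}"
  let ?high = "{e \<in> E - h. t \<le> likelihood_ratio P Q (A e)}"
  from sel have S: "S \<subseteq> E" "card S = k"
    and top: "\<And>e f. e \<in> S \<Longrightarrow> f \<in> E - S \<Longrightarrow> likelihood_ratio P Q (A f) \<le> likelihood_ratio P Q (A e)"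
    by (auto simp: top_likelihood_selection_def)
  have fin: "finite S" "finite h"
    using S \<open>h \<subseteq> E\<close> \<open>finite E\<close> finite_subset by auto
  show ?thesis
  proof (cases "\<exists>e\<in>S. likelihood_ratio P Q (A e) < t")
    case True
    then have "h \<subseteq> (S \<inter> h) \<union> ?low"
      using top \<open>h \<subseteq> E\<close> by force
    then have "card h \<le> card (S \<inter> h) + card ?low"
      using fin by (intro order_trans [OF card_mono card_Un_le]) auto
    with few_low \<open>card h = k\<close> show ?thesis
      by linarith
  next
    case False
    then have "S \<subseteq> (S \<inter> h) \<union> ?high"
      using S by force
    then have "card S \<le> card (S \<inter> h) + card ?high"
      using fin \<open>finite E\<close> by (intro order_trans [OF card_mono card_Un_le]) auto
    with few_high \<open>card S = k\<close> show ?thesis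
      by linarith
  qed
qed

section \<open>Success probability for a fixed and for a random hidden graph\<close>

context abs_cont_prob_pair
begin

text \<open>Projecting a product of probability measures to one coordinate returns the law of that
  coordinate.\<close>

lemma
  assumes "e \<in> E" and pred: "Measurable.pred Q R"
  shows sets_component_weight:
      "{A \<in> space (\<Pi>\<^sub>M e\<in>E. if e \<in> h then P else Q). R (A e)}
        \<in> sets (\<Pi>\<^sub>M e\<in>E. if e \<in> h then P else Q)" (is "?X \<in> sets ?M")
    and prob_component_weight:
      "measure (\<Pi>\<^sub>M e\<in>E. if e \<in> h then P else Q)
        {A \<in> space (\<Pi>\<^sub>M e\<in>E. if e \<in> h then P else Q). R (A e)}
        = (if e \<in> h then P.prob {x \<in> space P. R x} else Q.prob {x \<in> space Q. R x})"
proof -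
  let ?W = "\<lambda>e. if e \<in> h then P else Q"
  have comp [measurable]: "(\<lambda>A. A e) \<in> measurable ?M (?W e)"
    by (rule measurable_component_singleton [OF \<open>e \<in> E\<close>])
  have R [measurable]: "Measurable.pred (?W e) R"
    using pred sets_eq by (auto simp: space_eq cong: measurable_cong_sets)
  show "?X \<in> sets ?M"
    by measurable
  have "measure (?W e) {x \<in> space (?W e). R x}
      = measure (distr ?M (?W e) (\<lambda>A. A e)) {x \<in> space (?W e). R x}"
    using \<open>e \<in> E\<close> P.prob_space_axioms Q.prob_space_axioms
    by (subst distr_PiM_component) auto
  also have "\<dots> = measure ?M ((\<lambda>A. A e) -` {x \<in> space (?W e). R x} \<inter> space ?M)"
    by (rule measure_distr) measurable
  also have "(\<lambda>A. A e) -` {x \<in> space (?W e). R x} \<inter> space ?M = ?X"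
    using measurable_space [OF comp] by auto
  finally show "measure ?M ?X = (if e \<in> h then P.prob {x \<in> space P. R x} else Q.prob {x \<in> space Q. R x})"
    by (simp split: if_splits)
qed

text \<open>\<open>G\<close> is any measurable set containing all weight vectors for which every
  selection succeeds. This form lets a section of an event in the joint space be inserted
  later.\<close>

lemma prob_overlap_fixed_graph:
  fixes c t :: real
  assumes "finite E" "h \<subseteq> E" "card h = k" "0 < c" "0 < t"
    and G: "G \<in> sets (\<Pi>\<^sub>M e\<in>E. if e \<in> h then P else Q)"
    and G_I: "\<And>A. A \<in> space (\<Pi>\<^sub>M e\<in>E. if e \<in> h then P else Q) \<Longrightarrow>
      (\<And>S. top_likelihood_selection E k P Q A S \<Longrightarrow> real k - c < real (card (S \<inter> h))) \<Longrightarrow> A \<in> G"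
  shows "1 - (real k * P.prob {x \<in> space P. likelihood_ratio P Q x < t} + real (card E) / t) / c
    \<le> measure (\<Pi>\<^sub>M e\<in>E. if e \<in> h then P else Q) G"
proof -
  let ?L = "likelihood_ratio P Q"
  let ?M = "\<Pi>\<^sub>M e\<in>E. if e \<in> h then P else Q"
  interpret M: prob_space ?M
    by (intro prob_space_PiM) (simp add: P.prob_space_axioms Q.prob_space_axioms)
  have fin: "finite h"
    using assms finite_subset by auto
  define B1 where "B1 = {A \<in> space ?M. c \<le> real (card {e \<in> h. ?L (A e) < t})}"
  define B2 where "B2 = {A \<in> space ?M. c \<le> real (card {e \<in> E - h. t \<le> ?L (A e)})}"
  have low_sets: "{A \<in> space ?M. ?L (A e) < t} \<in> sets ?M" if "e \<in> h" for e
    using that \<open>h \<subseteq> E\<close> by (intro sets_component_weight) auto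
  have high_sets: "{A \<in> space ?M. t \<le> ?L (A e)} \<in> sets ?M" if "e \<in> E - h" for e
    using that by (intro sets_component_weight) auto
  have "M.prob B1 \<le> (\<Sum>e\<in>h. M.prob {A \<in> space ?M. ?L (A e) < t}) / c"
    unfolding B1_def by (intro M.prob_card_ge fin \<open>0 < c\<close> low_sets)
  also have "(\<Sum>e\<in>h. M.prob {A \<in> space ?M. ?L (A e) < t})
      = (\<Sum>e\<in>h. P.prob {x \<in> space P. ?L x < t})"
    using \<open>h \<subseteq> E\<close> by (intro sum.cong refl, subst prob_component_weight) auto
  also have "\<dots> = real k * P.prob {x \<in> space P. ?L x < t}"
    using \<open>card h = k\<close> by simp
  finally have B1: "M.prob B1 \<le> real k * P.prob {x \<in> space P. ?L x < t} / c" .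
  have "M.prob B2 \<le> (\<Sum>e\<in>E - h. M.prob {A \<in> space ?M. t \<le> ?L (A e)}) / c"
    unfolding B2_def by (intro M.prob_card_ge \<open>0 < c\<close> high_sets) (use \<open>finite E\<close> in auto)
  also have "(\<Sum>e\<in>E - h. M.prob {A \<in> space ?M. t \<le> ?L (A e)})
      = (\<Sum>e\<in>E - h. Q.prob {x \<in> space Q. t \<le> ?L x})"
    by (intro sum.cong refl, subst prob_component_weight) auto
  also have "\<dots> = real (card (E - h)) * Q.prob {x \<in> space Q. t \<le> ?L x}"
    by simp
  also have "\<dots> \<le> real (card E) * (1 / t)"
    using \<open>0 < t\<close> \<open>finite E\<close> prob_likelihood_ratio_ge
    by (intro mult_mono) (auto intro: card_mono)
  finally have B2: "M.prob B2 \<le> real (card E) / t / c"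
    using \<open>0 < c\<close> by (simp add: divide_right_mono)
  \<comment> \<open>Outside \<open>G\<close> some selection fails, so one of the two counts must
    reach \<open>c\<close>.\<close>
  have "space ?M - G \<subseteq> B1 \<union> B2"
  proof
    fix A assume A: "A \<in> space ?M - G"
    then obtain S where S: "top_likelihood_selection E k P Q A S"
      "\<not> real k - c < real (card (S \<inter> h))"
      using G_I by blast
    then show "A \<in> B1 \<union> B2"
      using A top_likelihood_selection_overlap [OF assms(1-3) S(1), of t c]
      by (force simp: B1_def B2_def not_less)
  qed
  moreover have B_sets: "B1 \<in> M.events" "B2 \<in> M.events"
  proof -
    \<comment> \<open>On the space, the count is a finite sum of indicators of measurable
      sets.\<close>
    have card_meas: "(\<lambda>A. real (card {e \<in> I. R (A e)})) \<in> borel_measurable ?M"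
      if "finite I" "\<And>e. e \<in> I \<Longrightarrow> {A \<in> space ?M. R (A e)} \<in> sets ?M" for I and R :: "'a \<Rightarrow> bool"
    proof -
      have "(\<lambda>A. \<Sum>e\<in>I. indicator {A \<in> space ?M. R (A e)} A :: real) \<in> borel_measurable ?M"
        using that by measurable
      also have "?this \<longleftrightarrow> (\<lambda>A. real (card {e \<in> I. R (A e)})) \<in> borel_measurable ?M"
        using \<open>finite I\<close> by (intro measurable_cong) (simp add: indicator_def Int_def)
      finally show ?thesis .
    qed
    have [measurable]: "(\<lambda>A. real (card {e \<in> h. ?L (A e) < t})) \<in> borel_measurable ?M"
      using fin low_sets by (rule card_meas)
    have [measurable]: "(\<lambda>A. real (card {e \<in> E - h. t \<le> ?L (A e)})) \<in> borel_measurable ?M"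
      using \<open>finite E\<close> high_sets by (intro card_meas) auto
    show "B1 \<in> M.events" "B2 \<in> M.events"
      unfolding B1_def B2_def by measurable
  qed
  ultimately have "M.prob (space ?M - G) \<le> M.prob (B1 \<union> B2)"
    by (intro M.finite_measure_mono) auto
  also have "\<dots> \<le> M.prob B1 + M.prob B2"
    using B_sets by (intro measure_Un_le) auto
  finally have "1 - M.prob G \<le> M.prob B1 + M.prob B2"
    using M.prob_compl [OF G] by simp
  with B1 B2 show ?thesis
    by (simp add: add_divide_distrib)
qed

text \<open>The bound for a fixed graph, taken with \<open>c = \<epsilon> k\<close>, is the same for
  every \<open>h\<close> in \<open>H\<close> and therefore survives averaging over
  \<open>h\<close>.\<close>

lemma prob_overlap_hidden_weighted_graph:
  fixes \<epsilon> t :: real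
  assumes "finite E" "H \<noteq> {}" "\<And>h. h \<in> H \<Longrightarrow> h \<subseteq> E \<and> card h = k" "0 < k" "0 < \<epsilon>" "0 < t"
  shows "prob_space (hidden_weighted_graph E H P Q)"
    and "1 - (P.prob {x \<in> space P. likelihood_ratio P Q x < t} + real (card E) / real k / t) / \<epsilon>
    \<le> \<P>((h, A) in hidden_weighted_graph E H P Q. \<forall>S. top_likelihood_selection E k P Q A S \<longrightarrow>
        (1 - \<epsilon>) * real k < real (card (S \<inter> h)))"
proof -
  let ?N = "count_space UNIV \<Otimes>\<^sub>M (\<Pi>\<^sub>M e\<in>E. Q)"
  let ?M = "\<lambda>h. \<Pi>\<^sub>M e\<in>E. if e \<in> h then P else Q"
  let ?K = "\<lambda>h. distr (?M h) ?N (Pair h)"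
  let ?B = "1 - (P.prob {x \<in> space P. likelihood_ratio P Q x < t} + real (card E) / real k / t) / \<epsilon>"
  have fin: "finite H"
    using assms by (intro finite_subset [of H "Pow E"]) auto
  have sets_M: "sets (?M h) = sets (\<Pi>\<^sub>M e\<in>E. Q)" for h
    by (rule sets_PiM_cong) (auto simp: sets_eq)
  have space_M: "space (?M h) = space (\<Pi>\<^sub>M e\<in>E. Q)" for h
    by (rule sets_eq_imp_space_eq [OF sets_M])
  have prob_M: "prob_space (?M h)" for h
    by (intro prob_space_PiM) (simp add: P.prob_space_axioms Q.prob_space_axioms)
  have Pair_meas: "Pair h \<in> measurable (?M h) ?N" for h
    by (subst measurable_cong_sets [OF sets_M refl]) simp
  have prob_K: "prob_space (?K h)" for h
    using prob_space.prob_space_distr [OF prob_M Pair_meas] .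
  have K: "?K \<in> measurable (measure_pmf (pmf_of_set H)) (subprob_algebra ?N)"
    by (auto simp: space_subprob_algebra intro: prob_space_imp_subprob_space prob_K)
  show "prob_space (hidden_weighted_graph E H P Q)"
    unfolding hidden_weighted_graph_def
    by (rule prob_space.prob_space_bind [OF measure_pmf.prob_space_axioms _ K]) (simp add: prob_K)
  have space_hwg: "space (hidden_weighted_graph E H P Q) = space ?N"
    unfolding hidden_weighted_graph_def by (rule space_bind) auto
  define G where "G = {(h, A) \<in> space ?N. \<forall>S. top_likelihood_selection E k P Q A S \<longrightarrow>
        (1 - \<epsilon>) * real k < real (card (S \<inter> h))}"
  \<comment> \<open>A selection is a subset of \<open>E\<close>, so the quantifier over
    \<open>S\<close> is really finite; this gives measurability.\<close>
  have G_alt: "G = {x \<in> space ?N. \<forall>S\<in>Pow E. (card S = k \<and>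
      (\<forall>e\<in>S. \<forall>f\<in>E - S. likelihood_ratio P Q (snd x f) \<le> likelihood_ratio P Q (snd x e))) \<longrightarrow>
      (1 - \<epsilon>) * real k < real (card (S \<inter> fst x))}"
    by (auto simp: G_def top_likelihood_selection_def)
  have G_sets: "G \<in> sets ?N"
  proof -
    have lr: "(\<lambda>x. likelihood_ratio P Q (snd x e)) \<in> borel_measurable ?N" if "e \<in> E" for e
      using that by measurable
    have top: "Measurable.pred ?N (\<lambda>x. \<forall>e\<in>S. \<forall>f\<in>E - S.
        likelihood_ratio P Q (snd x f) \<le> likelihood_ratio P Q (snd x e))" if "S \<in> Pow E" for S
    proof -
      have "finite S" "finite (E - S)"
        using that \<open>finite E\<close> finite_subset by auto
      moreover have "Measurable.pred ?N (\<lambda>x. likelihood_ratio P Q (snd x f) \<le> likelihood_ratio P Q (snd x e))"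
        if "e \<in> E" "f \<in> E" for e f
        using lr [OF that(1)] lr [OF that(2)] by measurable
      ultimately show ?thesis
        using that by (intro pred_intros_finite) auto
    qed
    have over: "Measurable.pred ?N (\<lambda>x. (1 - \<epsilon>) * real k < real (card (S \<inter> fst x)))" for S
      by (rule measurable_compose [OF measurable_fst]) simp
    show ?thesis
      unfolding G_alt
    proof (rule predE, rule pred_intros_finite)
      show "finite (Pow E)"
        using \<open>finite E\<close> by simp
    qed (intro pred_intros_logic top over; simp)
  qed
  have bound: "?B \<le> measure (?K h) G" if "h \<in> H" for h
  proof -
    have h: "h \<subseteq> E" "card h = k"
      using assms that by auto
    have "?B = 1 - (real k * P.prob {x \<in> space P. likelihood_ratio P Q x < t}
        + real (card E) / t) / (\<epsilon> * real k)"
      using assms by (simp add: field_simps)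
    also have "\<dots> \<le> measure (?M h) (Pair h -` G \<inter> space (?M h))"
    proof (rule prob_overlap_fixed_graph [OF \<open>finite E\<close> h])
      show "Pair h -` G \<inter> space (?M h) \<in> sets (?M h)"
        using Pair_meas G_sets by (rule measurable_sets)
    next
      fix A assume "A \<in> space (?M h)"
        "\<And>S. top_likelihood_selection E k P Q A S \<Longrightarrow> real k - \<epsilon> * real k < real (card (S \<inter> h))"
      then show "A \<in> Pair h -` G \<inter> space (?M h)"
        by (auto simp: G_def space_M space_pair_measure algebra_simps)
    qed (use assms in auto)
    also have "\<dots> = measure (?K h) G"
      using Pair_meas G_sets by (rule measure_distr [symmetric])
    finally show ?thesis .
  qed
  \<comment> \<open>The integrals over \<open>h\<close> are finite averages, since \<open>H\<close>
    is a set of subsets of the finite \<open>E\<close>.\<close>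
  have "?B = (\<integral>h. ?B \<partial>measure_pmf (pmf_of_set H))"
    by simp
  also have "\<dots> \<le> (\<integral>h. measure (?K h) G \<partial>measure_pmf (pmf_of_set H))"
    using fin \<open>H \<noteq> {}\<close> bound
    by (intro integral_mono_AE integrable_measure_pmf_finite)
      (auto simp: AE_measure_pmf_iff)
  also have "\<dots> = measure (hidden_weighted_graph E H P Q) G"
    unfolding hidden_weighted_graph_def
    using measure_pmf.subprob_space_axioms K G_sets
    by (intro subprob_space.measure_bind [symmetric])
  also have "G = {(h, A) \<in> space (hidden_weighted_graph E H P Q).
      \<forall>S. top_likelihood_selection E k P Q A S \<longrightarrow> (1 - \<epsilon>) * real k < real (card (S \<inter> h))}"
    by (auto simp: G_def space_hwg)
  finally show "?B \<le> \<P>((h, A) in hidden_weighted_graph E H P Q. \<forall>S. top_likelihood_selection E k P Q A S \<longrightarrow>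
        (1 - \<epsilon>) * real k < real (card (S \<inter> h)))" .
qed

end

section \<open>Asymptotics on the complete graph\<close>

lemma finite_complete_graph_edges: "finite (complete_graph_edges n)"
  by (rule finite_subset [of _ "Pow {1..n}"]) (auto simp: complete_graph_edges_def)

lemma card_complete_graph_edges: "card (complete_graph_edges n) = n choose 2"
  using n_subsets [of "{1..n}" 2] by (simp add: complete_graph_edges_def)

theorem lemma26:
  fixes H :: "nat \<Rightarrow> nat set set set"
    and m :: "nat \<Rightarrow> nat"
    and P Q :: "nat \<Rightarrow> 'a measure"
    and p1M :: "nat \<Rightarrow> real"
    and \<eta> :: real
  assumes H_nonempty: "\<And>n. n \<ge> 1 \<Longrightarrow> H n \<noteq> {}"
    and H_subgraphs: "\<And>n h. n \<ge> 1 \<Longrightarrow> h \<in> H n \<Longrightarrow> h \<subseteq> complete_graph_edges n \<and> card h = m n"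
    and m_at_top: "filterlim m at_top sequentially"
    and prob_P: "\<And>n. n \<ge> 1 \<Longrightarrow> prob_space (P n)"
    and prob_Q: "\<And>n. n \<ge> 1 \<Longrightarrow> prob_space (Q n)"
    and sets_P_Q: "\<And>n. n \<ge> 1 \<Longrightarrow> sets (P n) = sets (Q n)"
    and ac_P_Q: "\<And>n. n \<ge> 1 \<Longrightarrow> absolutely_continuous (Q n) (P n)"
    and p1M_def: "\<And>n. n \<ge> 1 \<Longrightarrow> p1M n = real (card (H n)) powr (- 1 / real (m n))"
    and stable: "renyi_stable_upper P Q"
    and rate_equiv: "(\<lambda>n. ln (1 / p1M n)) \<sim>[sequentially] (\<lambda>n. ln (real (n choose 2) / real (m n)))"
    and rate_omega: "(\<lambda>n. ln (1 / p1M n)) \<in> \<omega>(\<lambda>_. 1)"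
    and eta_pos: "\<eta> > 0"
    and KL_eq: "\<forall>\<^sub>F n in sequentially. KL_div (P n) (Q n) = (1 + \<eta>) * ln (1 / p1M n)"
  shows "\<exists>\<epsilon>::nat \<Rightarrow> real. \<epsilon> \<longlonglongrightarrow> 0 \<and>
    (\<lambda>n. \<P>((h, A) in hidden_weighted_graph (complete_graph_edges n) (H n) (P n) (Q n).
       \<forall>S. top_likelihood_selection (complete_graph_edges n) (m n) (P n) (Q n) A S \<longrightarrow>
           real (card (S \<inter> h)) > (1 - \<epsilon> n) * real (m n)))
    \<longlonglongrightarrow> 1"
proof -
  define l where "l n = ln (1 / p1M n)" for n
  define E where "E n = complete_graph_edges n" for n
  define D where "D n = KL_div (P n) (Q n)" for n
  \<comment> \<open>Chosen so that, once \<open>D = (1 + \<eta>) l\<close>, the Renyi lower bound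
    \<open>(1 - \<theta>) D\<close> exceeds the threshold exponent \<open>(1 + \<eta> / 2) l\<close>
    by exactly \<open>\<theta> D = \<eta> / 4 l\<close>.\<close>
  define \<theta> where "\<theta> = \<eta> / 4 / (1 + \<eta>)"
  \<comment> \<open>The exponent lies halfway between \<open>l\<close>, the growth rate of
    \<open>ln (N / m)\<close>, and \<open>D\<close>.\<close>
  define t where "t n = exp ((1 + \<eta> / 2) * l n)" for n
  have \<theta>: "\<theta> > 0" "(1 - \<theta>) * (1 + \<eta>) = 1 + \<eta> / 2 + \<theta> * (1 + \<eta>)"
    using eta_pos by (simp_all add: \<theta>_def field_simps)
  from stable \<theta>(1) obtain \<alpha> where \<alpha>: "\<And>n. 0 < \<alpha> n" "\<And>n. \<alpha> n < 1"
    and \<alpha>_omega: "(\<lambda>n. 1 - \<alpha> n) \<in> \<omega>(\<lambda>n. 1 / D n)"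
    and renyi: "\<forall>\<^sub>F n in sequentially. renyi_divergence (\<alpha> n) (P n) (Q n) \<ge> (1 - \<theta>) * D n"
    unfolding renyi_stable_upper_def D_def by blast
  have D_eq: "\<forall>\<^sub>F n in sequentially. D n = (1 + \<eta>) * l n"
    using KL_eq by (simp add: D_def l_def)
  have large: "\<forall>\<^sub>F n in sequentially. n \<ge> 1 \<and> m n \<ge> 1"
    using m_at_top by (auto simp: filterlim_at_top eventually_ge_at_top eventually_conj_iff)

  define r where "r n = ln (real (n choose 2) / real (m n))" for n
  have l_equiv: "l \<sim>[sequentially] r"
    using rate_equiv by (simp add: l_def [abs_def] r_def [abs_def])
  \<comment> \<open>Some graph with \<open>m\<close> edges fits into the complete graph, so m \<le>
    N. This fixes the sign of \<open>l\<close>, for which the growth assumption controls only the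
    absolute value.\<close>
  have r_nonneg: "\<forall>\<^sub>F n in sequentially. 0 \<le> r n"
    using large
  proof eventually_elim
    case (elim n)
    then obtain h where "h \<in> H n"
      using H_nonempty by blast
    then have "m n \<le> n choose 2"
      using H_subgraphs elim card_mono [OF finite_complete_graph_edges, of h n]
      by (auto simp: card_complete_graph_edges)
    with elim show ?case
      by (simp add: r_def)
  qed
  have norm_l: "filterlim (\<lambda>n. \<bar>l n\<bar>) at_top sequentially"
    using smallomegaD_filterlim_at_top_norm [OF rate_omega] by (simp add: l_def)
  \<comment> \<open>Asymptotic equivalence reads 0 / 0 as 1; since \<open>l\<close> is eventually
    nonzero, the plain quotient converges.\<close>
  have ratio: "((\<lambda>n. r n / l n) \<longlongrightarrow> 1) sequentially"
  proof -
    have "r \<sim>[sequentially] l"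
      using l_equiv by (rule asymp_equiv_symI)
    moreover have "\<forall>\<^sub>F n in sequentially. l n \<noteq> 0"
      using norm_l by (auto simp: filterlim_at_top_dense elim!: allE [of _ 0] eventually_mono)
    ultimately show ?thesis
      by (rule asymp_equivD_strong [OF _ eventually_mono]) auto
  qed
  \<comment> \<open>The quotient is eventually positive and its numerator nonnegative, so its
    denominator is positive.\<close>
  have l_pos: "\<forall>\<^sub>F n in sequentially. 0 < l n"
    using order_tendstoD(1) [OF ratio zero_less_one] r_nonneg
    by eventually_elim (auto simp: zero_less_divide_iff)
  have l_top: "filterlim l at_top sequentially"
    using norm_l by (rule filterlim_mono_eventually) (use l_pos in \<open>auto elim: eventually_mono\<close>)
  have r_le: "\<forall>\<^sub>F n in sequentially. r n \<le> (1 + \<eta> / 4) * l n"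
  proof -
    have "\<forall>\<^sub>F n in sequentially. r n / l n < 1 + \<eta> / 4"
      using eta_pos by (intro order_tendstoD(2) [OF ratio]) simp
    with l_pos show ?thesis
      by eventually_elim (simp add: pos_divide_less_eq)
  qed

  \<comment> \<open>\<open>\<delta> n / \<epsilon>\<close> is the failure bound of the finite model
    for tolerance \<open>\<epsilon>\<close>.\<close>
  define \<delta> where "\<delta> n = measure (P n) {x \<in> space (P n). likelihood_ratio (P n) (Q n) x < t n}
    + real (card (E n)) / real (m n) / t n" for n
  define u where "u n = exp (- (\<theta> * ((1 - \<alpha> n) * D n))) + exp (- (\<eta> / 4 * l n))" for n
  have pair: "abs_cont_prob_pair (P n) (Q n)" if "n \<ge> 1" for n
    using that prob_P prob_Q sets_P_Q ac_P_Q
    by (simp add: abs_cont_prob_pair_def abs_cont_prob_pair_axioms_def)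
  have \<delta>_le: "\<forall>\<^sub>F n in sequentially. \<delta> n \<le> u n"
    using large D_eq renyi l_pos r_le
  proof eventually_elim
    case (elim n)
    interpret abs_cont_prob_pair "P n" "Q n"
      using pair elim by simp
    have "measure (P n) {x \<in> space (P n). likelihood_ratio (P n) (Q n) x < t n}
        \<le> exp (- (1 - \<alpha> n) * (renyi_divergence (\<alpha> n) (P n) (Q n) - (1 + \<eta> / 2) * l n))"
      unfolding t_def using \<alpha> by (rule prob_likelihood_ratio_less)
    also have "\<dots> \<le> exp (- (\<theta> * ((1 - \<alpha> n) * D n)))"
    proof -
      have "\<theta> * D n = (1 - \<theta>) * D n - (1 + \<eta> / 2) * l n"
        using arg_cong [OF \<theta>(2), of "\<lambda>x. x * l n"] elim by (simp add: algebra_simps)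
      also have "\<dots> \<le> renyi_divergence (\<alpha> n) (P n) (Q n) - (1 + \<eta> / 2) * l n"
        using elim by simp
      finally have "(1 - \<alpha> n) * (\<theta> * D n)
          \<le> (1 - \<alpha> n) * (renyi_divergence (\<alpha> n) (P n) (Q n) - (1 + \<eta> / 2) * l n)"
        using \<alpha>(2) [of n] by (intro mult_left_mono) auto
      moreover have "\<theta> * ((1 - \<alpha> n) * D n) = (1 - \<alpha> n) * (\<theta> * D n)"
        by simp
      ultimately show ?thesis
        unfolding exp_le_cancel_iff by linarith
    qed
    finally have low: "measure (P n) {x \<in> space (P n). likelihood_ratio (P n) (Q n) x < t n}
      \<le> exp (- (\<theta> * ((1 - \<alpha> n) * D n)))" .
    \<comment> \<open>At 0 the convention \<open>ln 0 = 0\<close> makes the right-hand side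
      1.\<close>
    have "x \<le> exp (ln x)" if "0 \<le> x" for x :: real
      using that by (cases "x = 0") auto
    then have "real (card (E n)) / real (m n) \<le> exp (r n)"
      by (simp add: r_def E_def card_complete_graph_edges)
    \<comment> \<open>The exponents on the right add up to \<open>(1 + \<eta> / 4) l\<close>, the
      bound on \<open>r\<close> in \<open>r_le\<close>.\<close>
    also have "\<dots> \<le> exp (- (\<eta> / 4 * l n)) * t n"
      using elim by (simp add: t_def algebra_simps flip: exp_add)
    finally have "real (card (E n)) / real (m n) / t n \<le> exp (- (\<eta> / 4 * l n))"
      by (subst pos_divide_le_eq) (simp_all add: t_def)
    with low show ?case
      by (simp add: \<delta>_def u_def)
  qed
  have \<delta>_nonneg: "0 \<le> \<delta> n" for n
    by (simp add: \<delta>_def t_def)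
  have "u \<longlonglongrightarrow> 0 + 0"
    unfolding u_def
  proof (rule tendsto_add)
    \<comment> \<open>The little-omega condition says that this norm diverges; it equals
      \<open>(1 - \<alpha>) D\<close> once \<open>D\<close> is positive.\<close>
    have "filterlim (\<lambda>n. norm ((1 - \<alpha> n) / (1 / D n))) at_top sequentially"
      using D_eq l_pos eta_pos
      by (intro smallomegaD_filterlim_at_top_norm [OF \<alpha>_omega]) (auto elim: eventually_elim2)
    then have "filterlim (\<lambda>n. (1 - \<alpha> n) * D n) at_top sequentially"
    proof (rule filterlim_mono_eventually)
      show "\<forall>\<^sub>F n in sequentially. norm ((1 - \<alpha> n) / (1 / D n)) = (1 - \<alpha> n) * D n"
        using D_eq l_pos
        by eventually_elim (use \<alpha>(2) eta_pos in \<open>auto simp: abs_mult less_imp_le\<close>)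
    qed auto
    then have "filterlim (\<lambda>n. \<theta> * ((1 - \<alpha> n) * D n)) at_top sequentially"
      by (rule filterlim_tendsto_pos_mult_at_top [OF tendsto_const \<theta>(1)])
    then show "(\<lambda>n. exp (- (\<theta> * ((1 - \<alpha> n) * D n)))) \<longlonglongrightarrow> 0"
      by (intro filterlim_compose [OF exp_at_bot] filterlim_compose [OF filterlim_uminus_at_bot_at_top])
    have "filterlim (\<lambda>n. \<eta> / 4 * l n) at_top sequentially"
      using eta_pos by (intro filterlim_tendsto_pos_mult_at_top [OF tendsto_const _ l_top]) simp
    then show "(\<lambda>n. exp (- (\<eta> / 4 * l n))) \<longlonglongrightarrow> 0"
      by (intro filterlim_compose [OF exp_at_bot] filterlim_compose [OF filterlim_uminus_at_bot_at_top])
  qed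
  then have u_lim: "u \<longlonglongrightarrow> 0"
    by simp
  \<comment> \<open>The square root balances tolerance and failure probability: the latter is at
    most \<open>u / \<epsilon> = \<epsilon>\<close>, so both vanish.\<close>
  define \<epsilon> where "\<epsilon> n = sqrt (u n)" for n
  have u_pos: "0 < u n" for n
    by (simp add: u_def add_pos_pos)
  have \<epsilon>_lim: "\<epsilon> \<longlonglongrightarrow> 0"
    using tendsto_real_sqrt [OF u_lim] by (simp add: \<epsilon>_def [abs_def])
  let ?p = "\<lambda>n. \<P>((h, A) in hidden_weighted_graph (complete_graph_edges n) (H n) (P n) (Q n).
       \<forall>S. top_likelihood_selection (complete_graph_edges n) (m n) (P n) (Q n) A S \<longrightarrow>
           real (card (S \<inter> h)) > (1 - \<epsilon> n) * real (m n))"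
  have "?p \<longlonglongrightarrow> 1"
  proof (rule tendsto_sandwich)
    show "\<forall>\<^sub>F n in sequentially. 1 - \<epsilon> n \<le> ?p n"
      using large \<delta>_le
    proof eventually_elim
      case (elim n)
      interpret abs_cont_prob_pair "P n" "Q n"
        using pair elim by simp
      have "\<delta> n / \<epsilon> n \<le> u n / \<epsilon> n"
        using elim u_pos [of n] by (simp add: \<epsilon>_def divide_right_mono)
      also have "\<dots> = \<epsilon> n"
        using u_pos [of n] by (simp add: \<epsilon>_def real_div_sqrt less_imp_le)
      finally have "1 - \<epsilon> n \<le> 1 - \<delta> n / \<epsilon> n"
        by simp
      also have "\<dots> \<le> ?p n"
        unfolding \<delta>_def E_def
        by (rule prob_overlap_hidden_weighted_graph(2))
          (use elim H_nonempty H_subgraphs u_pos in \<open>auto simp: t_def \<epsilon>_def finite_complete_graph_edges\<close>)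
      finally show ?case .
    qed
    show "\<forall>\<^sub>F n in sequentially. ?p n \<le> 1"
      using large
    proof eventually_elim
      case (elim n)
      interpret abs_cont_prob_pair "P n" "Q n"
        using pair elim by simp
      have "prob_space (hidden_weighted_graph (complete_graph_edges n) (H n) (P n) (Q n))"
        \<comment> \<open>The values 1 are arbitrary positive choices, as the conclusion mentions
          neither \<open>\<epsilon>\<close> nor \<open>t\<close>.\<close>
        by (rule prob_overlap_hidden_weighted_graph(1) [where k = "m n" and \<epsilon> = 1 and t = 1])
          (use elim H_nonempty H_subgraphs in \<open>auto simp: finite_complete_graph_edges\<close>)
      then show ?case
        by (rule prob_space.prob_le_1)
    qed
    show "(\<lambda>n. 1 - \<epsilon> n) \<longlonglongrightarrow> 1"
      using tendsto_diff [OF tendsto_const \<epsilon>_lim, of 1] by simp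
  qed simp
  with \<epsilon>_lim show ?thesis
    by blast
qed

end
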